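(* Let $T:\mathbb{Z}_{>0}\to\mathbb{Z}_{>0}$ be defined by $T(n)=(3n+1)/2$ if $n$ is odd and $T(n)=n/2$ if $n$ is even, and let $\rho=\log_2 3$. Let $1\le q<j$ be integers with $r=q/j\le \rho^{-1}$, and let $n$ be a positive integer such that exactly $q$ of the integers $n,T(n),\ldots,T^{(j-1)}(n)$ are odd and such that the terms $n,T(n),\ldots,T^{(j)}(n)$ are pairwise distinct. Then $$n\ge j^{-1/6}\cdot 2^{(1-\rho r)j}.$$ If moreover $r\le r_H$, where $r_H=0.609089767\ldots$ is the unique non-zero real number satisfying $H(r_H)\log 2=r_H\log 3$, then $$n\ge j^{-1/6}\cdot 2^{(1-H(r))j}.$$
   Context: $T^{(k)}$ denotes the $k$-th iterate of $T$ (with $T^{(0)}$ the identity). $H$ is the binary entropy function $H(x)=-x\log_2 x-(1-x)\log_2(1-x)$ on $[0,1]$, extended by continuity with $H(0)=H(1)=0$. *)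

theory Defs
  imports "HOL-Analysis.Analysis"
begin

(* The map T on positive integers.  The value T 0 = 0 is a junk value: T maps positive
   numbers to positive numbers, and it is only iterated from positive starting points. *)
definition T :: "nat \<Rightarrow> nat" where
  "T n = (if odd n then (3 * n + 1) div 2 else n div 2)"

definition rho :: real where
  "rho = log 2 3"

(* Only meaningful on the interval [0,1]. *)
definition H :: "real \<Rightarrow> real" where
  "H x = (if x = 0 \<or> x = 1 then 0 else - x * log 2 x - (1 - x) * log 2 (1 - x))"

(* The restriction to [0,1] is the domain of H; HOL's log is total, so without it
   arguments outside the domain could intrude. *)
definition is_r_H :: "real \<Rightarrow> bool" where
  "is_r_H x \<longleftrightarrow> x \<in> {0..1} \<and> x \<noteq> 0 \<and> H x * ln 2 = x * ln 3"

(* Existence and uniqueness are not built into this description; they have to be proved. *)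
definition r_H :: real where
  "r_H = (THE x. is_r_H x)"

end

theory Submission
  imports Defs
begin

text \<open>
  If $q$ of the first $j$ iterates are odd, then $2^j T^{(j)}(n) = 3^q n P$, where $P$ is the
  product of $1 + 1/(3m)$ over the odd iterates $m$. Because these are distinct, $P$ is at most
  the same product over the first $q$ admissible odd numbers, which grows like $q^{1/6}$; the
  constant is good enough once $m = 1$ is excluded, and $m = 1$ can only occur as the
  penultimate term, where $T^{(j)}(n) = 2$ makes up for the loss. The second bound follows
  from the first: $H(x)/x$ is decreasing and takes the value $\rho$ at $r_H$, so that
  $H(r) \ge \rho r$ for $r \le r_H$.
\<close>

section \<open>The product over the odd iterates\<close>

text \<open>An odd term m satisfies 2 T(m) = 3m (1 + 1/(3m)) and an even one 2 T(m) = m; the product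
  of these relations along the orbit telescopes.\<close>

lemma T_funpow_product:
  "2 ^ k * real ((T ^^ k) n) =
     3 ^ card {i. i < k \<and> odd ((T ^^ i) n)} * real n *
     (\<Prod>i\<in>{i. i < k \<and> odd ((T ^^ i) n)}. 1 + 1 / (3 * real ((T ^^ i) n)))"
proof (induction k)
  case 0
  then show ?case by simp
next
  case (Suc k)
  let ?S = "\<lambda>k. {i. i < k \<and> odd ((T ^^ i) n)}"
  let ?m = "(T ^^ k) n"
  show ?case
  proof (cases "odd ?m")
    case True
    then have S: "?S (Suc k) = insert k (?S k)" by (auto simp: less_Suc_eq)
    have "even (3 * ?m + 1)" using True by simp
    then have "2 * T ?m = 3 * ?m + 1" using True by (simp add: T_def)
    then have "2 * real (T ?m) = 3 * real ?m + 1"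
      by linarith
    also have "\<dots> = 3 * real ?m * (1 + 1 / (3 * real ?m))"
      using True by (auto simp: field_simps elim: oddE)
    finally have step: "2 * real (T ?m) = 3 * real ?m * (1 + 1 / (3 * real ?m))" .
    have "2 ^ Suc k * real ((T ^^ Suc k) n) = 2 ^ k * (2 * real (T ?m))" by simp
    also have "\<dots> = 2 ^ k * real ?m * (3 * (1 + 1 / (3 * real ?m)))"
      unfolding step by (simp only: mult_ac)
    also have "\<dots> = 3 ^ card (?S (Suc k)) * real n *
        (\<Prod>i\<in>?S (Suc k). 1 + 1 / (3 * real ((T ^^ i) n)))"
    proof -
      have "card (?S (Suc k)) = Suc (card (?S k))" unfolding S by (subst card_insert_disjoint) auto
      moreover have "(\<Prod>i\<in>?S (Suc k). 1 + 1 / (3 * real ((T ^^ i) n))) =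
          (1 + 1 / (3 * real ?m)) * (\<Prod>i\<in>?S k. 1 + 1 / (3 * real ((T ^^ i) n)))"
        unfolding S by (subst prod.insert) auto
      ultimately show ?thesis unfolding Suc.IH by (simp only: power_Suc mult_ac)
    qed
    finally show ?thesis .
  next
    case False
    then have S: "?S (Suc k) = ?S k" by (auto simp: less_Suc_eq)
    have "2 * T ?m = ?m" using False by (simp add: T_def)
    then have step: "2 * real (T ?m) = real ?m" by linarith
    have "2 ^ Suc k * real ((T ^^ Suc k) n) = 2 ^ k * (2 * real (T ?m))" by simp
    then show ?thesis unfolding step S Suc.IH .
  qed
qed

text \<open>With y = 1/(3(2q+1)) the right side is (1+3y)/(1-3y), which agrees with (1+y)^6 to first
  order. This is the source of the exponent 1/6: the factor of the q-th odd number from 3 on is at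
  most ((q+1)/q)^(1/6), which telescopes.\<close>

lemma one_plus_power6_le:
  fixes q :: nat
  assumes "q \<ge> 1"
  shows "(1 + 1 / (3 * (2 * real q + 1))) ^ 6 \<le> (real q + 1) / real q"
proof -
  define y where "y = 1 / (3 * (2 * real q + 1))"
  have y: "y > 0" by (simp add: y_def)
  have q: "real q > 0" using assms by simp
  have p: "1 + 3 * y = (2 * real q + 2) / (2 * real q + 1)"
    and m: "1 - 3 * y = 2 * real q / (2 * real q + 1)"
    using q by (simp_all add: y_def field_simps)
  have ratio: "(1 + 3 * y) / (1 - 3 * y) = (real q + 1) / real q"
    unfolding p m using q by (subst frac_eq_eq) (simp_all add: algebra_simps)
  have "1 - 3 * y > 0"
    using q unfolding m by simp
  \<comment> \<open>After multiplication by 1 - 3y, all coefficients from degree two on are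
    negative.\<close>
  moreover have "(1 + y) ^ 6 * (1 - 3 * y) = 1 + 3 * y -
      (3 * y^2 + 25 * y^3 + 45 * y^4 + 39 * y^5 + 17 * y^6 + 3 * y^7)"
    by (simp add: algebra_simps eval_nat_numeral)
  moreover have "3 * y^2 + 25 * y^3 + 45 * y^4 + 39 * y^5 + 17 * y^6 + 3 * y^7 \<ge> 0"
    using y by simp
  ultimately have "(1 + y) ^ 6 \<le> (1 + 3 * y) / (1 - 3 * y)"
    by (simp add: pos_le_divide_eq)
  then show ?thesis unfolding ratio by (simp add: y_def)
qed

text \<open>Induction removes the maximum, which among k+1 distinct odd numbers from 3 on is at
  least 2(k+1) + 1.\<close>

lemma prod_distinct_odd_le:
  fixes S :: "nat set"
  assumes "finite S" "\<And>m. m \<in> S \<Longrightarrow> odd m \<and> m \<ge> 3"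
  shows "(\<Prod>m\<in>S. 1 + 1 / (3 * real m)) \<le> (real (card S) + 1) powr (1/6)"
  using assms
proof (induction "card S" arbitrary: S)
  case 0
  then show ?case by simp
next
  case (Suc k)
  define M where "M = Max S"
  have "S \<noteq> {}" using Suc.hyps(2) by auto
  then have M: "M \<in> S" using Suc.prems(1) by (simp add: M_def)
  \<comment> \<open>Counting the odd numbers from 3 to M bounds the size of S by (M - 1)/2, hence M
    from below.\<close>
  have "S \<subseteq> (\<lambda>i. 2 * i + 1) ` {1..(M - 1) div 2}"
  proof
    fix m assume m: "m \<in> S"
    then have "m \<le> M" using Suc.prems(1) by (simp add: M_def)
    moreover have "odd m" "m \<ge> 3" using Suc.prems(2)[OF m] by auto
    ultimately show "m \<in> (\<lambda>i. 2 * i + 1) ` {1..(M - 1) div 2}"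
      by (intro image_eqI[of _ _ "m div 2"]) (auto elim!: oddE)
  qed
  from card_mono[OF _ this] have "card S \<le> card ((\<lambda>i. 2 * i + 1) ` {1..(M - 1) div 2})"
    by simp
  also have "\<dots> \<le> (M - 1) div 2" using card_image_le[of "{1..(M - 1) div 2}"] by simp
  finally have Mge: "M \<ge> 2 * Suc k + 1" using Suc.hyps(2) by presburger
  have card: "card (S - {M}) = k" using Suc.hyps(2) Suc.prems(1) M by simp
  define q where "q = real (Suc k)"
  have q: "q \<ge> 1" by (simp add: q_def)
  have IH: "(\<Prod>m\<in>S - {M}. 1 + 1 / (3 * real m)) \<le> q powr (1/6)"
    using Suc.hyps(1)[of "S - {M}"] Suc.prems card by (simp add: q_def add.commute)
  have "real M \<ge> 2 * q + 1"
    using Mge by (simp add: q_def flip: of_nat_le_iff[where ?'a = real])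
  then have "1 + 1 / (3 * real M) \<le> 1 + 1 / (3 * (2 * q + 1))"
    using q by (intro add_left_mono divide_left_mono) auto
  also have "\<dots> = ((1 + 1 / (3 * (2 * q + 1))) ^ 6) powr (1/6)"
  proof -
    have "z = (z ^ 6) powr (1/6)" if "z > 0" for z :: real
    proof -
      have "z ^ 6 = z powr 6" using that by (simp add: powr_numeral)
      then show ?thesis using that by (simp only: powr_powr) simp
    qed
    then show ?thesis using q by (simp add: add_pos_nonneg)
  qed
  also have "\<dots> \<le> ((q + 1) / q) powr (1/6)"
    using one_plus_power6_le[of "Suc k"] q by (intro powr_mono2) (auto simp: q_def)
  finally have fac: "1 + 1 / (3 * real M) \<le> ((q + 1) / q) powr (1/6)" .
  have "(\<Prod>m\<in>S. 1 + 1 / (3 * real m)) =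
      (1 + 1 / (3 * real M)) * (\<Prod>m\<in>S - {M}. 1 + 1 / (3 * real m))"
    using M Suc.prems(1) by (simp add: prod.remove)
  also have "\<dots> \<le> ((q + 1) / q) powr (1/6) * q powr (1/6)"
    using fac IH by (intro mult_mono) (auto intro!: prod_nonneg)
  also have "\<dots> = (q + 1) powr (1/6)"
    using q by (simp flip: powr_mult)
  finally show ?case using Suc.hyps(2)[symmetric] by (simp add: q_def)
qed

section \<open>The product along an orbit and the first bound\<close>

lemma T_pos: "n > 0 \<Longrightarrow> T n > 0"
  by (auto simp: T_def elim!: evenE)

lemma T_funpow_pos: "n > 0 \<Longrightarrow> (T ^^ k) n > 0"
  by (induction k) (auto simp: T_pos)

text \<open>The factor T^j(n) costs nothing, since it cancels against the left side of
  \<open>T_funpow_product\<close>; it is at least 1, and equals 2 in the one case where the term 1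
  contributes to the product.\<close>

lemma T_orbit_product_le:
  assumes "n > 0" and inj: "inj_on (\<lambda>i. (T ^^ i) n) {0..j}"
    and lt: "card {i. i < j \<and> odd ((T ^^ i) n)} < j"
  shows "(\<Prod>i\<in>{i. i < j \<and> odd ((T ^^ i) n)}. 1 + 1 / (3 * real ((T ^^ i) n)))
           \<le> real j powr (1/6) * real ((T ^^ j) n)"
proof -
  let ?O = "{i. i < j \<and> odd ((T ^^ i) n)}"
  let ?x = "\<lambda>i. (T ^^ i) n"
  let ?P = "\<lambda>S. \<Prod>m\<in>S. 1 + 1 / (3 * real m)"
  have injO: "inj_on ?x ?O" by (rule inj_on_subset[OF inj]) auto
  define S where "S = ?x ` ?O"
  have fin: "finite S" by (simp add: S_def)
  have card: "card S < j" using lt by (simp add: S_def card_image[OF injO])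
  have odd: "odd m" if "m \<in> S" for m using that by (auto simp: S_def)
  have ge3: "odd m \<and> m \<ge> 3" if "m \<in> S - {1}" for m
    using odd[of m] that by (auto elim!: oddE)
  have prod: "(\<Prod>i\<in>?O. 1 + 1 / (3 * real (?x i))) = ?P S"
    by (simp add: S_def prod.reindex[OF injO])
  have P_le: "?P (S - {1}) \<le> (real (card (S - {1})) + 1) powr (1/6)"
    using fin ge3 by (intro prod_distinct_odd_le) auto
  \<comment> \<open>Fewer than j odd terms occur, so the extra 1 still fits under j.\<close>
  also have "\<dots> \<le> real j powr (1/6)"
    using card card_Diff1_le[of S 1] by (intro powr_mono2) auto
  finally have P_le: "?P (S - {1}) \<le> real j powr (1/6)" .
  have "?P S \<le> real j powr (1/6) * real (?x j)"
  proof (cases "1 \<in> S")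
    case False
    have "real (?x j) \<ge> 1" using T_funpow_pos[OF assms(1), of j] by simp
    then have "real j powr (1/6) * 1 \<le> real j powr (1/6) * real (?x j)"
      by (intro mult_left_mono) auto
    then show ?thesis using P_le False by simp
  next
    case True
    then obtain i where i: "i < j" "?x i = 1" by (auto simp: S_def)
    have T12: "T (Suc 0) = 2" "T 2 = Suc 0" by (simp_all add: T_def)
    have "j = Suc i"
    \<comment> \<open>A term 1 with two successors in range would run through 1, 2, 1 and
      repeat.\<close>
    proof (rule ccontr)
      assume "j \<noteq> Suc i"
      then have "Suc (Suc i) \<le> j" using i by simp
      moreover have "?x (Suc (Suc i)) = ?x i" using i by (simp add: T12)
      ultimately show False using inj_onD[OF inj, of "Suc (Suc i)" i] by simp
    qed
    then have xj: "?x j = 2" using i by (simp add: T12)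
    \<comment> \<open>The term 1 contributes 1 + 1/3, which is below T^j(n) = 2.\<close>
    have "?P S = 4/3 * ?P (S - {1})" using True fin by (simp add: prod.remove)
    also have "\<dots> \<le> 2 * real j powr (1/6)" using P_le by (intro mult_mono) (auto intro: prod_nonneg)
    finally show ?thesis using xj by simp
  qed
  then show ?thesis by (simp add: prod)
qed

lemma T_orbit_lower_bound:
  assumes "n > 0" "inj_on (\<lambda>i. (T ^^ i) n) {0..j}"
    and q: "card {i. i < j \<and> odd ((T ^^ i) n)} = q" and lt: "q < j"
  shows "real n \<ge> real j powr (- 1 / 6) * 2 powr ((1 - rho * (real q / real j)) * real j)"
proof -
  define P where "P = (\<Prod>i\<in>{i. i < j \<and> odd ((T ^^ i) n)}. 1 + 1 / (3 * real ((T ^^ i) n)))"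
  have P: "P \<le> real j powr (1/6) * real ((T ^^ j) n)"
    unfolding P_def using assms by (intro T_orbit_product_le) auto
  have xpos: "real ((T ^^ j) n) > 0" using T_funpow_pos[OF assms(1)] by simp
  have "2 ^ j * real ((T ^^ j) n) = 3 ^ q * real n * P"
    using T_funpow_product[of j n] q by (simp add: P_def)
  also have "\<dots> \<le> 3 ^ q * real n * (real j powr (1/6) * real ((T ^^ j) n))"
    using P by (intro mult_left_mono) auto
  also have "\<dots> = (3 ^ q * real n * real j powr (1/6)) * real ((T ^^ j) n)"
    by (rule mult.assoc[symmetric])
  finally have "2 ^ j \<le> 3 ^ q * real n * real j powr (1/6)"
    using xpos by (rule mult_right_le_imp_le)
  then have main: "2 ^ j / 3 ^ q / real j powr (1/6) \<le> real n"
    using lt by (simp add: field_simps)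
  \<comment> \<open>Since 2^rho = 3, the claimed power of 2 is exactly 2^j / 3^q.\<close>
  have "(1 - rho * (real q / real j)) * real j = real j - rho * real q"
    using lt by (simp add: field_simps)
  then have "2 powr ((1 - rho * (real q / real j)) * real j) = 2 powr real j / (2 powr rho) powr real q"
    by (simp add: powr_diff powr_powr)
  also have "\<dots> = 2 ^ j / 3 ^ q" by (simp add: rho_def powr_realpow)
  finally have "2 powr ((1 - rho * (real q / real j)) * real j) = 2 ^ j / 3 ^ q" .
  moreover have "real j powr (- 1 / 6) = inverse (real j powr (1/6))"
    using powr_minus[of "real j" "1/6"] by simp
  ultimately have "real j powr (- 1 / 6) * 2 powr ((1 - rho * (real q / real j)) * real j) =
      2 ^ j / 3 ^ q / real j powr (1/6)"
    by (simp only: divide_inverse mult.commute)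
  then show ?thesis using main by (simp only:)
qed

section \<open>The entropy quotient and its value ln 3\<close>

text \<open>On (0,1) this is H(x) ln 2 / x, so the equation defining \<open>r_H\<close> becomes a
  level set of a monotone function.\<close>

definition entropy_quotient :: "real \<Rightarrow> real" where
  "entropy_quotient x = - ln x - (1 / x - 1) * ln (1 - x)"

lemma H_ln_2:
  assumes "0 < x" "x < 1"
  shows "H x * ln 2 = x * entropy_quotient x"
  using assms by (simp add: H_def entropy_quotient_def log_def field_simps)

text \<open>The derivative collapses to ln(1-t)/t^2, which is negative on (0,1).\<close>

lemma entropy_quotient_strict_antimono:
  assumes "0 < x" "x < y" "y < 1"
  shows "entropy_quotient y < entropy_quotient x"
proof (rule DERIV_neg_imp_decreasing[OF assms(2)])
  fix t assume t: "x \<le> t" "t \<le> y"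
  then have t01: "0 < t" "t < 1" using assms by auto
  have "(entropy_quotient has_real_derivative
      (- (1 / t) - ((- 1 / t^2) * ln (1 - t) + (1 / t - 1) * (- 1 / (1 - t))))) (at t)"
    unfolding entropy_quotient_def[abs_def] using t01
    by (auto intro!: derivative_eq_intros simp: power2_eq_square)
  moreover have "- (1 / t) - ((- 1 / t^2) * ln (1 - t) + (1 / t - 1) * (- 1 / (1 - t))) = ln (1 - t) / t^2"
    using t01 by (simp add: field_simps power2_eq_square)
  moreover have "ln (1 - t) / t^2 < 0"
    using t01 by (intro divide_neg_pos) auto
  ultimately show "\<exists>d. (entropy_quotient has_real_derivative d) (at t) \<and> d < 0"
    by auto
qed

lemma is_r_H_iff: "is_r_H x \<longleftrightarrow> 0 < x \<and> x < 1 \<and> entropy_quotient x = ln 3"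
proof (cases "0 < x \<and> x < 1")
  case True
  then show ?thesis by (simp add: is_r_H_def H_ln_2)
next
  case False
  \<comment> \<open>The endpoint 1 is no solution, because H(1) = 0 while ln 3 > 0.\<close>
  then show ?thesis by (cases "x = 1") (auto simp: is_r_H_def H_def)
qed

section \<open>Numerical location of \<open>r_H\<close>\<close>

text \<open>Gibbs' inequality, and the bound of the Kullback-Leibler divergence by the chi-square
  divergence; both follow from ln z <= z - 1, applied to the ratios c/x and x/c and their
  complements.\<close>

lemma cross_entropy_bounds:
  fixes x c :: real
  assumes "0 < x" "x < 1" "0 < c" "c < 1"
  shows "- x * ln x - (1 - x) * ln (1 - x) \<le> - x * ln c - (1 - x) * ln (1 - c)"
    and "- x * ln c - (1 - x) * ln (1 - c) - (x - c)^2 / (c * (1 - c))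
           \<le> - x * ln x - (1 - x) * ln (1 - x)"
proof -
  have ln_le: "u * (ln v - ln u) \<le> v - u" if "0 < u" "0 < v" for u v :: real
  proof -
    have "ln v - ln u \<le> v / u - 1"
      using ln_le_minus_one[of "v / u"] that by (simp add: ln_div)
    then have "u * (ln v - ln u) \<le> u * (v / u - 1)" using that by (intro mult_left_mono) auto
    also have "\<dots> = v - u" using that by (simp add: right_diff_distrib)
    finally show ?thesis .
  qed
  have "x * (ln c - ln x) + (1 - x) * (ln (1 - c) - ln (1 - x)) \<le> (c - x) + ((1 - c) - (1 - x))"
    using assms by (intro add_mono ln_le) auto
  then show "- x * ln x - (1 - x) * ln (1 - x) \<le> - x * ln c - (1 - x) * ln (1 - c)"
    by (simp add: algebra_simps)
  have ln_le': "u * (ln u - ln v) \<le> u * (u / v - 1)" if "0 < u" "0 < v" for u v :: real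
    using ln_le_minus_one[of "u / v"] that by (intro mult_left_mono) (auto simp: ln_div)
  have "x * (ln x - ln c) + (1 - x) * (ln (1 - x) - ln (1 - c))
      \<le> x * (x / c - 1) + (1 - x) * ((1 - x) / (1 - c) - 1)"
    using assms by (intro add_mono ln_le') auto
  also have "\<dots> = (x - c)^2 / (c * (1 - c))"
    using assms by (simp add: divide_simps) (simp add: algebra_simps power2_eq_square)
  finally show "- x * ln c - (1 - x) * ln (1 - c) - (x - c)^2 / (c * (1 - c))
      \<le> - x * ln x - (1 - x) * ln (1 - x)"
    by (simp add: algebra_simps)
qed

text \<open>The numerical bounds on $r_H$ compare the entropy at its endpoints with the cross entropy
  relative to 67/110, which lies within \<open>2 * 10^-6\<close> of $r_H$: the quadratic error is then
  below the required precision, and only $\ln(201/110)$ and $\ln(110/43)$ have to be estimated.\<close>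

lemma ln_201_110: "602824542266/10^12 \<le> ln (201/110 :: real)" "ln (201/110 :: real) \<le> 602824542267/10^12"
proof -
  have "ln (201/110 :: real) \<in> {602824542266/10^12..602824542267/10^12}"
    \<comment> \<open>The argument 10 is the number of terms of the series of ln in powers of
      (x-1)/(x+1).\<close>
    by (rule set_mp[OF _ ln_approx_bounds[of "201/110" 10]]) (simp_all add: eval_nat_numeral)
  then show "602824542266/10^12 \<le> ln (201/110 :: real)" "ln (201/110 :: real) \<le> 602824542267/10^12" by simp_all
qed

lemma ln_110_43: "939280250095/10^12 \<le> ln (110/43 :: real)" "ln (110/43 :: real) \<le> 939280250100/10^12"
proof -
  have "ln (110/43 :: real) \<in> {939280250095/10^12..939280250100/10^12}"
    by (rule set_mp[OF _ ln_approx_bounds[of "110/43" 14]]) (simp_all add: eval_nat_numeral)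
  then show "939280250095/10^12 \<le> ln (110/43 :: real)" "ln (110/43 :: real) \<le> 939280250100/10^12" by simp_all
qed

lemma entropy_quotient_times:
  "0 < x \<Longrightarrow> x < 1 \<Longrightarrow> x * entropy_quotient x = - x * ln x - (1 - x) * ln (1 - x)"
  by (simp add: entropy_quotient_def field_simps)

text \<open>Splitting off ln 3 makes it cancel against x ln 3 in both endpoint comparisons.\<close>

lemma ln_67_110: "ln (67/110 :: real) = ln (201/110) - ln 3"
  using ln_mult[of 3 "67/110 :: real"] by simp

lemma ln_43_110: "ln (1 - 67/110 :: real) = - ln (110/43)"
  using ln_inverse[of "110/43 :: real"] by simp

lemma entropy_quotient_lower: "ln 3 \<le> entropy_quotient 0.609089767"
proof -
  let ?x = "0.609089767 :: real"
  have E: "?x * entropy_quotient ?x = - ?x * ln ?x - (1 - ?x) * ln (1 - ?x)"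
    by (rule entropy_quotient_times) simp_all
  \<comment> \<open>A lower bound on the entropy incurs the quadratic error, here about 6 * 10^-12
    against a margin above 10^-9.\<close>
  have "?x * ln 3 \<le> - ?x * ln (67/110) - (1 - ?x) * ln (1 - 67/110)
      - (?x - 67/110)^2 / (67/110 * (1 - 67/110))"
    unfolding ln_67_110 ln_43_110 using ln_201_110 ln_110_43
    by (simp add: power2_eq_square field_simps)
  also have "\<dots> \<le> ?x * entropy_quotient ?x"
    unfolding E by (rule cross_entropy_bounds(2)) simp_all
  finally show ?thesis by simp
qed

lemma entropy_quotient_upper: "entropy_quotient 0.609089768 < ln 3"
proof -
  let ?x = "0.609089768 :: real"
  have E: "?x * entropy_quotient ?x = - ?x * ln ?x - (1 - ?x) * ln (1 - ?x)"
    by (rule entropy_quotient_times) simp_all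
  \<comment> \<open>From above, Gibbs' inequality suffices and there is no error term.\<close>
  have "?x * entropy_quotient ?x \<le> - ?x * ln (67/110) - (1 - ?x) * ln (1 - 67/110)"
    unfolding E by (rule cross_entropy_bounds(1)) simp_all
  also have "\<dots> < ?x * ln 3"
    unfolding ln_67_110 ln_43_110 using ln_201_110 ln_110_43
    by (simp add: field_simps)
  finally show ?thesis by simp
qed

text \<open>The intermediate value theorem between the two endpoints gives a solution within the
  bounds; strict monotonicity makes it the only one.\<close>

lemma r_H_ex1: "\<exists>!x. is_r_H x"
  and r_H_bounds: "0.609089767 \<le> r_H" "r_H < 0.609089768"
proof -
  have "continuous_on {0.609089767..0.609089768} entropy_quotient"
    unfolding entropy_quotient_def by (intro continuous_intros) auto
  then obtain x where x: "0.609089767 \<le> x" "x \<le> 0.609089768" "entropy_quotient x = ln 3"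
    using IVT2'[of entropy_quotient "0.609089768" "ln 3" "0.609089767"]
      entropy_quotient_lower entropy_quotient_upper by auto
  then have lt: "x < 0.609089768"
    using entropy_quotient_upper by (cases "x = 0.609089768") auto
  have isx: "is_r_H x" using x lt by (simp add: is_r_H_iff)
  have uniq: "y = x" if "is_r_H y" for y
    using that isx entropy_quotient_strict_antimono[of x y] entropy_quotient_strict_antimono[of y x]
    by (cases x y rule: linorder_cases) (auto simp: is_r_H_iff)
  show "\<exists>!x. is_r_H x" using isx uniq by blast
  have "r_H = x" unfolding r_H_def using isx uniq by (rule the_equality)
  then show "0.609089767 \<le> r_H" "r_H < 0.609089768" using x lt by auto
qed

section \<open>The entropy bound and the theorem\<close>

lemma rho_mult_le_H:
  assumes "0 < r" "r \<le> r_H"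
  shows "rho * r \<le> H r"
proof -
  have "is_r_H r_H" unfolding r_H_def using r_H_ex1 by (rule theI')
  then have rH: "r_H < 1" "entropy_quotient r_H = ln 3" by (simp_all add: is_r_H_iff)
  have "ln 3 \<le> entropy_quotient r"
    using entropy_quotient_strict_antimono[of r r_H] assms rH by (cases "r = r_H") auto
  then have "r * ln 3 \<le> H r * ln 2"
    using assms rH by (simp add: H_ln_2)
  then show ?thesis by (simp add: rho_def log_def field_simps)
qed

theorem theorem2p6:
  shows "(\<exists>!x. is_r_H x) \<and> 0.609089767 \<le> r_H \<and> r_H < 0.609089768 \<and>
    (\<forall>(q::nat) (j::nat) (n::nat) (r::real).
       1 \<le> q \<longrightarrow> q < j \<longrightarrow> r = real q / real j \<longrightarrow> r \<le> inverse rho \<longrightarrow>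
       0 < n \<longrightarrow> card {i. i < j \<and> odd ((T ^^ i) n)} = q \<longrightarrow>
       inj_on (\<lambda>i. (T ^^ i) n) {0..j} \<longrightarrow>
         real n \<ge> real j powr (- 1 / 6) * 2 powr ((1 - rho * r) * real j) \<and>
         (r \<le> r_H \<longrightarrow>
           real n \<ge> real j powr (- 1 / 6) * 2 powr ((1 - H r) * real j)))"
proof (intro conjI allI impI r_H_ex1 r_H_bounds)
  fix q j n :: nat and r :: real
  assume q: "1 \<le> q" "q < j" and r: "r = real q / real j" and n: "0 < n"
    and card: "card {i. i < j \<and> odd ((T ^^ i) n)} = q"
    and inj: "inj_on (\<lambda>i. (T ^^ i) n) {0..j}"
  show first: "real j powr (- 1 / 6) * 2 powr ((1 - rho * r) * real j) \<le> real n"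
    unfolding r by (rule T_orbit_lower_bound[OF n inj card q(2)])
  assume "r \<le> r_H"
  \<comment> \<open>Here q >= 1 makes r positive.\<close>
  then have "rho * r \<le> H r" using q r by (intro rho_mult_le_H) auto
  then have "2 powr ((1 - H r) * real j) \<le> 2 powr ((1 - rho * r) * real j)"
    by (intro powr_mono mult_right_mono) auto
  then have "real j powr (- 1 / 6) * 2 powr ((1 - H r) * real j)
      \<le> real j powr (- 1 / 6) * 2 powr ((1 - rho * r) * real j)"
    by (intro mult_left_mono) auto
  also note first
  finally show "real j powr (- 1 / 6) * 2 powr ((1 - H r) * real j) \<le> real n" .
qed

end
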